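(* Let $X$ be a finite ultrametric space such that all labels of different internal nodes of the representing tree $T_X$ are different. Then for every nonempty subspace $Y$ of $X$, all labels of different internal nodes of the representing tree $T_Y$ are different.
   Context: Representing tree: let $(X,d)$ be a finite nonempty ultrametric space. If $|X|\geq 2$, the diametrical graph of $X$ is the graph with vertex set $X$ in which $u,v$ are adjacent iff $d(u,v)=\operatorname{diam}X$, where $\operatorname{diam} X=\max\{d(x,y):x,y\in X\}$; it is always complete $k$-partite for some $k\geq 2$, with uniquely determined nonempty parts $X_1,\dots,X_k$. The representing tree $(T_X,l_X)$ is the rooted labeled tree whose nodes are subsets of $X$, defined recursively: if $|X|=1$, $T_X$ consists of the single node $X$ labeled $0$; if $|X|\geq 2$, the root $X$ is labeled $\operatorname{diam}X$, its children are the parts $X_1,\dots,X_k$ of the diametrical graph of $X$, each child $X_i$ is labeled $l_X(X_i)=\operatorname{diam}X_i$, and the construction is repeated for every $X_i$ with $|X_i|\geq2$. The leaves of $T_X$ are exactly the singletons $\{x\}$, $x\in X$ (labeled $0$); the other nodes are internal. Subspaces carry the restricted metric. *)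

theory Defs
  imports "HOL-Analysis.Analysis"
begin

text \<open>
  As in every instance of \<^locale>\<open>Metric_space\<close>, the function \<open>d\<close> is defined on the whole type and
  is symmetric and nonnegative there; only its values on the carrier matter.  The subspace of
  \<open>(X, d)\<close> on \<open>Y \<subseteq> X\<close> is \<open>(Y, d)\<close>.
\<close>

locale Ultrametric_space = Metric_space X d
  for X :: "'a set" and d :: "'a \<Rightarrow> 'a \<Rightarrow> real" +
  assumes strong_triangle:
    "\<And>x y z. \<lbrakk>x \<in> X; y \<in> X; z \<in> X\<rbrakk> \<Longrightarrow> d x z \<le> max (d x y) (d y z)"

lemma (in Ultrametric_space) ultrametric_subspace:
  assumes "Y \<subseteq> X"
  shows "Ultrametric_space Y d"
proof (intro Ultrametric_space.intro Ultrametric_space_axioms.intro)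
  show "Metric_space Y d" by (rule subspace[OF assms])
  show "d x z \<le> max (d x y) (d y z)" if "x \<in> Y" "y \<in> Y" "z \<in> Y" for x y z
    using that assms by (intro strong_triangle) auto
qed

definition diam :: "('a \<Rightarrow> 'a \<Rightarrow> real) \<Rightarrow> 'a set \<Rightarrow> real" where
  "diam d A = Max {d x y | x y. x \<in> A \<and> y \<in> A}"

definition diametrical_adj :: "('a \<Rightarrow> 'a \<Rightarrow> real) \<Rightarrow> 'a set \<Rightarrow> 'a \<Rightarrow> 'a \<Rightarrow> bool" where
  "diametrical_adj d A u v \<longleftrightarrow> u \<in> A \<and> v \<in> A \<and> d u v = diam d A"

definition complete_multipartite :: "'a set \<Rightarrow> ('a \<Rightarrow> 'a \<Rightarrow> bool) \<Rightarrow> 'a set set \<Rightarrow> bool" where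
  "complete_multipartite V E P \<longleftrightarrow>
     partition_on V P \<and> finite P \<and> 2 \<le> card P \<and>
     (\<forall>u\<in>V. \<forall>v\<in>V. E u v \<longleftrightarrow> \<not> (\<exists>B\<in>P. u \<in> B \<and> v \<in> B))"

definition diametrical_parts :: "('a \<Rightarrow> 'a \<Rightarrow> real) \<Rightarrow> 'a set \<Rightarrow> 'a set set" where
  "diametrical_parts d A = (THE P. complete_multipartite A (diametrical_adj d A) P)"

inductive_set rep_nodes :: "('a \<Rightarrow> 'a \<Rightarrow> real) \<Rightarrow> 'a set \<Rightarrow> 'a set set"
  for d :: "'a \<Rightarrow> 'a \<Rightarrow> real" and X :: "'a set" where
  root: "X \<in> rep_nodes d X"
| child: "\<lbrakk>A \<in> rep_nodes d X; 2 \<le> card A; B \<in> diametrical_parts d A\<rbrakk> \<Longrightarrow> B \<in> rep_nodes d X"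

record 'a labeled_rooted_tree =
  tree_nodes :: "'a set"
  tree_root :: 'a
  tree_arcs :: "('a \<times> 'a) set"
  tree_label :: "'a \<Rightarrow> real"

definition internal_nodes :: "'a labeled_rooted_tree \<Rightarrow> 'a set" where
  "internal_nodes T = {A \<in> tree_nodes T. \<exists>B. (A, B) \<in> tree_arcs T}"

text \<open>Arcs point from parent to child.  A singleton has label \<open>diam d {x} = d x x = 0\<close>.\<close>

definition representing_tree :: "('a \<Rightarrow> 'a \<Rightarrow> real) \<Rightarrow> 'a set \<Rightarrow> 'a set labeled_rooted_tree" where
  "representing_tree d X =
     \<lparr> tree_nodes = rep_nodes d X,
       tree_root = X,
       tree_arcs = {(A, B). A \<in> rep_nodes d X \<and> 2 \<le> card A \<and> B \<in> diametrical_parts d A},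
       tree_label = diam d \<rparr>"

text \<open>The definite description in \<^const>\<open>diametrical_parts\<close> is well defined.\<close>

lemma complete_multipartite_unique:
  assumes P: "complete_multipartite V E P" and Q: "complete_multipartite V E Q"
  shows "P = Q"
proof -
  have *: "P' = (\<lambda>u. {v \<in> V. \<not> E u v}) ` V" if "complete_multipartite V E P'" for P'
  proof -
    from that have part: "\<Union>P' = V" "disjoint P'" "{} \<notin> P'"
      and adj: "\<And>u v. \<lbrakk>u \<in> V; v \<in> V\<rbrakk> \<Longrightarrow> E u v \<longleftrightarrow> \<not> (\<exists>B\<in>P'. u \<in> B \<and> v \<in> B)"
      by (auto simp: complete_multipartite_def partition_on_def)
    have eq: "{v \<in> V. \<not> E u v} = B" if "B \<in> P'" "u \<in> B" for u B
    proof -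
      have "u \<in> V" using that part by auto
      have "\<And>C. \<lbrakk>C \<in> P'; u \<in> C\<rbrakk> \<Longrightarrow> C = B"
        using that part(2) by (auto simp: disjoint_def)
      then show ?thesis using that part(1) adj[OF \<open>u \<in> V\<close>] by blast
    qed
    show ?thesis
    proof (intro equalityI subsetI)
      fix B assume B: "B \<in> P'"
      with part(3) obtain u where "u \<in> B" by (metis ex_in_conv)
      with B eq part(1) show "B \<in> (\<lambda>u. {v \<in> V. \<not> E u v}) ` V" by blast
    next
      fix B assume "B \<in> (\<lambda>u. {v \<in> V. \<not> E u v}) ` V"
      then obtain u where "u \<in> V" "B = {v \<in> V. \<not> E u v}" by blast
      moreover from \<open>u \<in> V\<close> part(1) obtain C where "C \<in> P'" "u \<in> C" by blast
      ultimately show "B \<in> P'" using eq by simp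
    qed
  qed
  show ?thesis using *[OF P] *[OF Q] by simp
qed

context Ultrametric_space
begin

lemma diam_ge:
  assumes "finite A" "x \<in> A" "y \<in> A"
  shows "d x y \<le> diam d A"
proof -
  have "{d x y | x y. x \<in> A \<and> y \<in> A} = (\<lambda>(x, y). d x y) ` (A \<times> A)" by auto
  then have "finite {d x y | x y. x \<in> A \<and> y \<in> A}" using assms(1) by simp
  then show ?thesis unfolding diam_def using assms by (intro Max_ge) auto
qed

lemma diam_attained:
  assumes "finite A" "A \<noteq> {}"
  obtains x y where "x \<in> A" "y \<in> A" "d x y = diam d A"
proof -
  have eq: "{d x y | x y. x \<in> A \<and> y \<in> A} = (\<lambda>(x, y). d x y) ` (A \<times> A)" by auto
  have "Max {d x y | x y. x \<in> A \<and> y \<in> A} \<in> {d x y | x y. x \<in> A \<and> y \<in> A}"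
    by (rule Max_in) (use assms eq in auto)
  then show thesis using that unfolding diam_def by auto
qed

lemma diam_singleton: "x \<in> X \<Longrightarrow> diam d {x} = 0"
  by (simp add: diam_def)

lemma ex1_diametrical_parts:
  assumes "finite X" "A \<subseteq> X" "2 \<le> card A"
  shows "\<exists>!P. complete_multipartite A (diametrical_adj d A) P"
proof (rule ex_ex1I)
  have fin: "finite A" using assms finite_subset by blast
  define c where "c u = {v \<in> A. d u v < diam d A}" for u
  have A0: "A \<noteq> {}" using assms(3) by auto
  have pos: "0 < diam d A"
  proof -
    obtain x y where xy: "x \<in> A" "y \<in> A" "x \<noteq> y"
    proof -
      from A0 obtain x where x: "x \<in> A" by blast
      have "A \<noteq> {x}" using assms(3) by auto
      with x that show thesis by blast
    qed
    then have "d x y \<noteq> 0" using assms(2) zero[of x y] by blast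
    with nonneg[of x y] have "0 < d x y" by linarith
    also have "\<dots> \<le> diam d A" using diam_ge fin xy by blast
    finally show ?thesis .
  qed
  have refl: "u \<in> c u" if "u \<in> A" for u
    using that pos assms(2) by (auto simp: c_def)
  have tr: "d x z < diam d A"
    if "x \<in> A" "y \<in> A" "z \<in> A" "d x y < diam d A" "d y z < diam d A" for x y z
    using strong_triangle[of x y z] that assms(2) by (auto simp: subset_iff)
  have ceq: "c u = c v" if "u \<in> A" "v \<in> A" "w \<in> c u" "w \<in> c v" for u v w
  proof -
    from that have w: "w \<in> A" "d u w < diam d A" "d v w < diam d A" by (auto simp: c_def)
    then have uv: "d u v < diam d A" "d v u < diam d A"
      using tr[of u w v] that commute by metis+
    then show ?thesis using that tr unfolding c_def by blast
  qed
  have part: "partition_on A (c ` A)"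
  proof (rule partition_onI)
    show "\<Union> (c ` A) = A" using refl by (auto simp: c_def)
    show "disjnt p q" if "p \<in> c ` A" "q \<in> c ` A" "p \<noteq> q" for p q
      using that ceq unfolding disjnt_def by blast
    show "{} \<notin> c ` A" using refl by auto
  qed
  have adj: "diametrical_adj d A u v \<longleftrightarrow> \<not> (\<exists>B\<in>c ` A. u \<in> B \<and> v \<in> B)" if uv: "u \<in> A" "v \<in> A" for u v
  proof -
    have "(\<exists>B\<in>c ` A. u \<in> B \<and> v \<in> B) \<longleftrightarrow> v \<in> c u"
      using uv refl ceq by blast
    moreover have "v \<in> c u \<longleftrightarrow> d u v \<noteq> diam d A"
      using uv diam_ge[OF fin uv] by (auto simp: c_def)
    ultimately show ?thesis using uv by (simp add: diametrical_adj_def)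
  qed
  have "2 \<le> card (c ` A)"
  proof -
    obtain x y where xy: "x \<in> A" "y \<in> A" "d x y = diam d A"
      using diam_attained[OF fin A0] .
    then have "y \<notin> c x" "y \<in> c y" using refl by (auto simp: c_def)
    then have "c x \<noteq> c y" by blast
    then have "card {c x, c y} = 2" by simp
    moreover have "card {c x, c y} \<le> card (c ` A)"
      using xy fin by (intro card_mono) auto
    ultimately show ?thesis by simp
  qed
  with part adj fin show "\<exists>P. complete_multipartite A (diametrical_adj d A) P"
    unfolding complete_multipartite_def by blast
qed (rule complete_multipartite_unique)

lemma diametrical_parts:
  assumes "finite X" "A \<subseteq> X" "2 \<le> card A"
  shows "complete_multipartite A (diametrical_adj d A) (diametrical_parts d A)"
  unfolding diametrical_parts_def using ex1_diametrical_parts[OF assms] by (rule theI')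

end

end

(* In a representing tree every node is a closed ball of radius equal to its label, and any two
   points x \<noteq> y lie in a node labelled d x y (the smallest node containing both).  If two internal
   nodes of T_Y have the same label r, pick in each a pair at distance r.  The corresponding nodes
   of T_X have the same label r, so they coincide; hence the two pairs are at mutual distance at
   most r, and the two balls of radius r in Y are equal. *)

theory Submission
  imports Defs
begin

context Ultrametric_space
begin

text \<open>Used to see that a pair of points realising the label of an internal node is a pair of
  distinct points.\<close>

lemma diam_pos:
  assumes "A \<subseteq> X" "2 \<le> card A"
  shows "0 < diam d A"
proof -
  have fin: "finite A" using assms(2) card.infinite by fastforce
  obtain x y where xy: "x \<in> A" "y \<in> A" "x \<noteq> y"
    using assms(2) card_le_Suc0_iff_eq[OF fin] by fastforce
  then have "0 < d x y" using assms(1) mdist_pos_less by blast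
  also have "\<dots> \<le> diam d A" using diam_ge fin xy by blast
  finally show ?thesis .
qed

text \<open>Two points of \<open>A\<close> share a part iff they are not adjacent, that is, iff
  their distance is not \<open>diam d A\<close> and so lies below it. Thus a part is an open ball in
  \<open>A\<close> about any of its points.\<close>

lemma diametrical_part_eq:
  assumes "finite X" "A \<subseteq> X" "2 \<le> card A" "B \<in> diametrical_parts d A" "u \<in> B"
  shows "B = {v \<in> A. d u v < diam d A}"
proof -
  have fin: "finite A" using assms finite_subset by blast
  have part: "\<Union>(diametrical_parts d A) = A" "disjoint (diametrical_parts d A)"
    and adj: "\<And>u v. \<lbrakk>u \<in> A; v \<in> A\<rbrakk> \<Longrightarrow>
      d u v = diam d A \<longleftrightarrow> \<not> (\<exists>C\<in>diametrical_parts d A. u \<in> C \<and> v \<in> C)"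
    using diametrical_parts[OF assms(1-3)]
    by (auto simp: complete_multipartite_def partition_on_def diametrical_adj_def)
  have u: "u \<in> A" using part(1) assms(4,5) by blast
  \<comment> \<open>Disjointness turns "some part contains both \<open>u\<close> and
    \<open>v\<close>" into \<open>v \<in> B\<close>.\<close>
  have uniq: "C = B" if "C \<in> diametrical_parts d A" "u \<in> C" for C
    using part(2) assms(4,5) that by (auto simp: disjoint_def)
  have "v \<in> B \<longleftrightarrow> d u v < diam d A" if v: "v \<in> A" for v
  proof -
    have "v \<in> B \<longleftrightarrow> d u v \<noteq> diam d A" using adj[OF u v] uniq assms(4,5) by blast
    then show ?thesis using diam_ge[OF fin u v] by auto
  qed
  then show ?thesis using part(1) assms(4) by blast
qed

lemma diametrical_part_nonempty:
  assumes "finite X" "A \<subseteq> X" "2 \<le> card A" "B \<in> diametrical_parts d A"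
  shows "B \<noteq> {}"
  using diametrical_parts[OF assms(1-3)] assms(4)
  by (auto simp: complete_multipartite_def partition_on_def)

lemma diametrical_part_subset:
  assumes "finite X" "A \<subseteq> X" "2 \<le> card A" "B \<in> diametrical_parts d A"
  shows "B \<subseteq> A"
  using diametrical_part_eq[OF assms] by blast

text \<open>As \<open>B\<close> is finite, its diameter is attained by two of its points, and these
  are not adjacent in the diametrical graph of \<open>A\<close>.\<close>

lemma diam_diametrical_part_less:
  assumes "finite X" "A \<subseteq> X" "2 \<le> card A" "B \<in> diametrical_parts d A"
  shows "diam d B < diam d A"
proof -
  have "finite B" using diametrical_part_subset[OF assms] assms(1,2) finite_subset by metis
  then obtain x y where "x \<in> B" "y \<in> B" "d x y = diam d B"
    using diam_attained diametrical_part_nonempty[OF assms] by blast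
  then show ?thesis using diametrical_part_eq[OF assms] by fastforce
qed

lemma rep_nodes_subset:
  assumes "finite X" "A \<in> rep_nodes d X"
  shows "A \<subseteq> X"
  using assms(2)
proof induction
  case (child A B)
  then show ?case using diametrical_part_subset[OF assms(1)] by blast
qed simp

text \<open>Any point of a node serves as centre of the ball. For a child \<open>B\<close> of
  \<open>A\<close>, a point of \<open>X\<close> within \<open>diam d B\<close> of \<open>u\<close>
  is closer to \<open>u\<close> than \<open>diam d A\<close>; so it lies in \<open>A\<close> by
  induction, and then in the part of \<open>u\<close>, which is \<open>B\<close>.\<close>

lemma in_rep_node_iff:
  assumes "finite X" "A \<in> rep_nodes d X" "u \<in> A"
  shows "v \<in> A \<longleftrightarrow> v \<in> X \<and> d u v \<le> diam d A"
  using assms(2,3)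
proof (induction arbitrary: v)
  case root
  then show ?case using diam_ge[OF assms(1)] by blast
next
  case (child A B)
  have A: "A \<subseteq> X" using rep_nodes_subset[OF assms(1) child.hyps(1)] .
  note BA = diametrical_part_subset[OF assms(1) A child.hyps(2,3)]
  have "u \<in> A" using child.prems BA by blast
  then have A_iff: "v \<in> A \<longleftrightarrow> v \<in> X \<and> d u v \<le> diam d A" by (rule child.IH)
  have "B = {v \<in> A. d u v < diam d A}"
    by (rule diametrical_part_eq[OF assms(1) A child.hyps(2,3) child.prems])
  then have B_iff: "v \<in> B \<longleftrightarrow> v \<in> A \<and> d u v < diam d A" by blast
  have less: "diam d B < diam d A"
    by (rule diam_diametrical_part_less[OF assms(1) A child.hyps(2,3)])
  have "finite B" by (rule finite_subset[OF subset_trans[OF BA A] assms(1)])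
  then have "v \<in> B \<Longrightarrow> d u v \<le> diam d B" using diam_ge child.prems by simp
  then show ?case using A_iff B_iff less by auto
qed

text \<open>Take a node of least cardinality containing both points. If its diameter were not
  \<open>d x y\<close>, the points would be non-adjacent and share a part, which is a smaller
  node.\<close>

lemma ex_rep_node_diam_eq:
  assumes "finite X" "x \<in> X" "y \<in> X" "x \<noteq> y"
  obtains A where "A \<in> rep_nodes d X" "2 \<le> card A" "x \<in> A" "y \<in> A" "diam d A = d x y"
proof -
  let ?P = "\<lambda>A. A \<in> rep_nodes d X \<and> x \<in> A \<and> y \<in> A"
  have "?P X" using assms rep_nodes.root by auto
  then obtain A where A: "?P A" and min: "\<And>B. ?P B \<Longrightarrow> card A \<le> card B"
    using ex_has_least_nat[of ?P X card] by blast
  have sub: "A \<subseteq> X" using rep_nodes_subset[OF assms(1)] A by blast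
  then have fin: "finite A" using assms(1) finite_subset by blast
  have card: "2 \<le> card A"
    using card_mono[OF fin, of "{x, y}"] A assms(4) by simp
  have "diam d A = d x y"
  proof (rule ccontr)
    assume "diam d A \<noteq> d x y"
    then obtain B where B: "B \<in> diametrical_parts d A" "x \<in> B" "y \<in> B"
      using diametrical_parts[OF assms(1) sub card] A
      unfolding complete_multipartite_def diametrical_adj_def by metis
    \<comment> \<open>The inclusion is strict because the diameters differ.\<close>
    have "B \<subset> A"
      using diametrical_part_subset[OF assms(1) sub card B(1)]
        diam_diametrical_part_less[OF assms(1) sub card B(1)] by auto
    then have "card B < card A" using fin psubset_card_mono by blast
    moreover have "?P B" using B A card rep_nodes.child by blast
    ultimately show False using min by fastforce
  qed
  then show thesis using that A card by blast
qed

text \<open>A node with at least two points does have an outgoing arc, since its diametrical graph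
  has at least two parts.\<close>

lemma internal_nodes_representing_tree:
  assumes "finite X"
  shows "internal_nodes (representing_tree d X) = {A \<in> rep_nodes d X. 2 \<le> card A}"
proof -
  have "diametrical_parts d A \<noteq> {}" if "A \<in> rep_nodes d X" "2 \<le> card A" for A
    using diametrical_parts[OF assms rep_nodes_subset[OF assms that(1)] that(2)]
    by (auto simp: complete_multipartite_def)
  then show ?thesis by (auto simp: internal_nodes_def representing_tree_def)
qed

end

theorem mainTheorem4:
  fixes X Y :: "'a set" and d :: "'a \<Rightarrow> 'a \<Rightarrow> real"
  assumes "Ultrametric_space X d" and "finite X"
    and "inj_on (tree_label (representing_tree d X)) (internal_nodes (representing_tree d X))"
    and "Y \<subseteq> X" and "Y \<noteq> {}"
  shows "inj_on (tree_label (representing_tree d Y)) (internal_nodes (representing_tree d Y))"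
proof -
  interpret X: Ultrametric_space X d by fact
  interpret Y: Ultrametric_space Y d by (rule X.ultrametric_subspace) fact
  have finY: "finite Y" using assms(2,4) finite_subset by blast
  have label: "tree_label (representing_tree d Z) = diam d" for Z
    by (simp add: representing_tree_def)
  have inj: "inj_on (diam d) {A \<in> rep_nodes d X. 2 \<le> card A}"
    using assms(3) X.internal_nodes_representing_tree[OF assms(2)] label by simp
  \<comment> \<open>The link between the trees: \<open>A'\<close> is a node of the tree of
    \<open>X\<close> with the label of \<open>A\<close>, found from a pair in \<open>A\<close> at
    distance \<open>diam d A\<close>. Only one point of the pair is kept, as a common centre of the
    two balls.\<close>
  have witness: "\<exists>a\<in>A. \<exists>A'. A' \<in> rep_nodes d X \<and> 2 \<le> card A' \<and> a \<in> A' \<and> diam d A' = diam d A"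
    if "A \<in> rep_nodes d Y" "2 \<le> card A" for A
  proof -
    have sub: "A \<subseteq> Y" using Y.rep_nodes_subset[OF finY that(1)] .
    have "finite A" "A \<noteq> {}" using sub finY finite_subset that(2) by auto
    then obtain a a' where a: "a \<in> A" "a' \<in> A" "d a a' = diam d A"
      using Y.diam_attained by blast
    have aX: "a \<in> X" "a' \<in> X" using a sub assms(4) by auto
    then have "a \<noteq> a'" using Y.diam_pos[OF sub that(2)] a(3) X.zero[of a a'] by auto
    then obtain A' where "A' \<in> rep_nodes d X" "2 \<le> card A'" "a \<in> A'" "diam d A' = d a a'"
      using X.ex_rep_node_diam_eq[OF assms(2) aX] by blast
    with a show ?thesis by auto
  qed
  have "inj_on (diam d) {A \<in> rep_nodes d Y. 2 \<le> card A}"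
  proof (rule inj_onI, clarify)
    fix A B
    assume A: "A \<in> rep_nodes d Y" "2 \<le> card A" and B: "B \<in> rep_nodes d Y" "2 \<le> card B"
      and eq: "diam d A = diam d B"
    obtain a A' where a: "a \<in> A" and A': "A' \<in> rep_nodes d X" "2 \<le> card A'" "a \<in> A'"
      "diam d A' = diam d A"
      using witness[OF A] by blast
    obtain b B' where b: "b \<in> B" and B': "B' \<in> rep_nodes d X" "2 \<le> card B'" "b \<in> B'"
      "diam d B' = diam d B"
      using witness[OF B] by blast
    \<comment> \<open>Here the hypothesis on \<open>X\<close> enters; it puts \<open>a\<close> and
      \<open>b\<close> into one ball of radius \<open>diam d A\<close> in \<open>X\<close>.\<close>
    have "A' = B'" using inj_onD[OF inj] A' B' eq by simp
    then have "d a b \<le> diam d A"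
      using X.in_rep_node_iff[OF assms(2) A'(1,3), of b] A'(4) B'(3) by simp
    moreover have "b \<in> Y" using Y.rep_nodes_subset[OF finY B(1)] b by blast
    ultimately have "b \<in> A" using Y.in_rep_node_iff[OF finY A(1) a] by blast
    \<comment> \<open>Both nodes contain \<open>b\<close>, so each is the closed ball in
      \<open>Y\<close> about \<open>b\<close> with the common label as radius.\<close>
    then show "A = B"
      using Y.in_rep_node_iff[OF finY A(1)] Y.in_rep_node_iff[OF finY B(1) b] eq by auto
  qed
  then show ?thesis using Y.internal_nodes_representing_tree[OF finY] label by simp
qed

end
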